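(* For $k\ge 1$ let $$\mathcal{E}^{(k)}(\mathbb{Z}_3) := \{\lambda\in\mathbb{Z}_3 : \text{for at least } k \text{ integers } n \ge 0, \text{ the 3-adic expansion of } \lambda 2^n \text{ omits the digit } 2\}.$$ Then: (1) $\dim_H(\mathcal{E}^{(1)}(\mathbb{Z}_3)) = \log_3 2 \approx 0.63092$. (2) $\frac{1}{2}\log_3 2 \le \dim_H(\mathcal{E}^{(2)}(\mathbb{Z}_3)) \le \frac{1}{2}$. (3) $\mathcal{E}^{(3)}(\mathbb{Z}_3)$ has positive Hausdorff dimension, bounded by $\frac{1}{6}\log_3 2 \le \dim_H(\mathcal{E}^{(3)}(\mathbb{Z}_3)) \le \dim_H(\mathcal{E}^{(2)}(\mathbb{Z}_3))$.
   Context: Every $3$-adic integer has a unique expansion $\lambda=\sum_{j=0}^\infty d_j 3^j$ with $d_j\in\{0,1,2\}$; it "omits the digit 2" if every $d_j\in\{0,1\}$. $\dim_H$ denotes Hausdorff dimension with respect to the $3$-adic metric on $\mathbb{Z}_3$, normalized so that each residue class modulo $3^j$ has diameter $3^{-j}$. *)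

theory Defs
  imports "HOL-Analysis.Analysis"
begin

section \<open>The ring of 3-adic integers\<close>

text \<open>
  The 3-adic integers as the inverse limit of the rings of integers modulo \<open>3 ^ n\<close>:
  \<open>residue x n\<close> is the representative in \<open>{0..<3 ^ n}\<close> of \<open>x\<close> modulo \<open>3 ^ n\<close>
  (the coherence condition forces it into this range).
\<close>

typedef padic3 = "{x :: nat \<Rightarrow> int. \<forall>n. x n = x (Suc n) mod 3 ^ n}"
  morphisms residue Abs_padic3
  by (rule exI[of _ "\<lambda>_. 0"]) simp

setup_lifting type_definition_padic3

lemma residue_Suc_mod: "residue x (Suc n) mod 3 ^ n = residue x n"
  using residue[of x] unfolding mem_Collect_eq by metis

lemma residue_mod: "m \<le> n \<Longrightarrow> residue x n mod 3 ^ m = residue x m"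
proof (induction n rule: dec_induct)
  case base
  show ?case by (metis residue_Suc_mod mod_mod_trivial)
next
  case (step n)
  have "(3::int) ^ m dvd 3 ^ n" using step by (simp add: le_imp_power_dvd)
  then have "residue x (Suc n) mod 3 ^ m = (residue x (Suc n) mod 3 ^ n) mod 3 ^ m"
    by (simp add: mod_mod_cancel)
  then show ?case using step residue_Suc_mod by simp
qed

lemma residue_mod_self [simp]: "residue x n mod 3 ^ n = residue x n"
  by (rule residue_mod) simp

lemma residue_0 [simp]: "residue x 0 = 0"
  using residue_mod_self[of x 0] by simp

lemma residue_nonneg: "0 \<le> residue x n" and residue_less: "residue x n < 3 ^ n"
proof -
  have "0 \<le> residue x n mod 3 ^ n" "residue x n mod 3 ^ n < 3 ^ n"
    by (simp_all del: residue_mod_self)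
  then show "0 \<le> residue x n" "residue x n < 3 ^ n" by simp_all
qed

lemma padic3_eqI: "(\<And>n. residue x n = residue y n) \<Longrightarrow> x = y"
  by (metis ext residue_inject)

lemma mod_3_power_Suc: "(a::int) mod 3 ^ Suc n mod 3 ^ n = a mod 3 ^ n"
  by (rule mod_mod_cancel) simp

instantiation padic3 :: comm_ring_1
begin

lift_definition zero_padic3 :: padic3 is "\<lambda>_. 0" by simp

lift_definition one_padic3 :: padic3 is "\<lambda>n. 1 mod 3 ^ n"
  by (metis mod_3_power_Suc)

lift_definition plus_padic3 :: "padic3 \<Rightarrow> padic3 \<Rightarrow> padic3"
  is "\<lambda>x y n. (x n + y n) mod 3 ^ n"
  by (metis mod_3_power_Suc mod_add_eq)

lift_definition minus_padic3 :: "padic3 \<Rightarrow> padic3 \<Rightarrow> padic3"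
  is "\<lambda>x y n. (x n - y n) mod 3 ^ n"
  by (metis mod_3_power_Suc mod_diff_eq)

lift_definition uminus_padic3 :: "padic3 \<Rightarrow> padic3"
  is "\<lambda>x n. (- x n) mod 3 ^ n"
  by (metis mod_3_power_Suc mod_minus_eq)

lift_definition times_padic3 :: "padic3 \<Rightarrow> padic3 \<Rightarrow> padic3"
  is "\<lambda>x y n. (x n * y n) mod 3 ^ n"
  by (metis mod_3_power_Suc mod_mult_eq)

instance
proof
  fix a b c :: padic3
  note ops = zero_padic3.rep_eq one_padic3.rep_eq plus_padic3.rep_eq minus_padic3.rep_eq
    uminus_padic3.rep_eq times_padic3.rep_eq
  show "a + b + c = a + (b + c)"
    by (rule padic3_eqI) (simp add: ops mod_simps add.assoc)
  show "a + b = b + a" by (rule padic3_eqI) (simp add: ops add.commute)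
  show "0 + a = a" by (rule padic3_eqI) (simp add: ops)
  show "- a + a = 0" by (rule padic3_eqI) (simp add: ops mod_simps)
  show "a - b = a + - b" by (rule padic3_eqI) (simp add: ops mod_simps)
  show "a * b * c = a * (b * c)"
    by (rule padic3_eqI) (simp add: ops mod_simps mult.assoc)
  show "a * b = b * a" by (rule padic3_eqI) (simp add: ops mult.commute)
  show "1 * a = a" by (rule padic3_eqI) (simp add: ops mod_simps)
  show "(a + b) * c = a * c + b * c"
    by (rule padic3_eqI) (simp add: ops mod_simps distrib_right)
  have "residue 0 1 \<noteq> residue 1 1" by (simp add: ops)
  then show "(0::padic3) \<noteq> 1" by metis
qed

end

lemmas residue_ops = zero_padic3.rep_eq one_padic3.rep_eq plus_padic3.rep_eq
  minus_padic3.rep_eq uminus_padic3.rep_eq times_padic3.rep_eq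

lemma residue_of_nat: "residue (of_nat m) n = int m mod 3 ^ n"
  by (induction m) (simp_all add: residue_ops mod_simps)

lemma residue_of_int: "residue (of_int m) n = m mod 3 ^ n"
  by (cases m rule: int_diff_cases) (simp add: residue_ops residue_of_nat mod_simps)

lemma residue_eq_iff_dvd: "residue x n = residue y n \<longleftrightarrow> 3 ^ n dvd x - y"
proof
  assume eq: "residue x n = residue y n"
  define z where "z = x - y"
  have z0: "residue z n = 0" using eq by (simp add: z_def residue_ops)
  have dv: "3 ^ n dvd residue z (m + n)" for m
    using residue_mod[of n "m + n" z] z0 by (simp add: mod_eq_0_iff_dvd)
  define w where "w = Abs_padic3 (\<lambda>m. residue z (m + n) div 3 ^ n)"
  have coh: "residue z (m + n) div 3 ^ n = residue z (Suc m + n) div 3 ^ n mod 3 ^ m" for m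
  proof -
    have "residue z (m + n) = residue z (Suc m + n) mod (3 ^ n * 3 ^ m)"
      using residue_Suc_mod[of z "m + n"] by (simp add: power_add mult.commute)
    also have "\<dots> = 3 ^ n * (residue z (Suc m + n) div 3 ^ n mod 3 ^ m)
        + residue z (Suc m + n) mod 3 ^ n"
      by (rule zmod_zmult2_eq) simp
    also have "residue z (Suc m + n) mod 3 ^ n = 0" using dv[of "Suc m"] by simp
    finally show ?thesis by simp
  qed
  have w: "residue w m = residue z (m + n) div 3 ^ n" for m
    unfolding w_def
    by (subst Abs_padic3_inverse, unfold mem_Collect_eq, intro allI coh, rule refl)
  have "z = 3 ^ n * w"
  proof (rule padic3_eqI)
    fix m
    have "residue (3 ^ n * w) m = residue (of_int (3 ^ n)) m * residue w m mod 3 ^ m"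
      by (simp add: residue_ops)
    also have "\<dots> = 3 ^ n * (residue z (m + n) div 3 ^ n) mod 3 ^ m"
      by (simp only: residue_of_int w mod_simps)
    also have "\<dots> = residue z (m + n) mod 3 ^ m" using dv[of m] by simp
    also have "\<dots> = residue z m" by (rule residue_mod) simp
    finally show "residue z m = residue (3 ^ n * w) m" by simp
  qed
  then show "3 ^ n dvd x - y" by (simp add: z_def)
next
  assume "3 ^ n dvd x - y"
  then obtain w where "x - y = 3 ^ n * w" by blast
  then have "x = y + of_int (3 ^ n) * w" by (simp add: algebra_simps)
  then have "residue x n = (residue y n + 3 ^ n * residue w n) mod 3 ^ n"
    by (simp only: residue_ops residue_of_int mod_simps)
  then show "residue x n = residue y n" by simp
qed


section \<open>The 3-adic metric\<close>

lemma residue_eq_mono: "residue x n = residue y n \<Longrightarrow> m \<le> n \<Longrightarrow> residue x m = residue y m"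
  by (metis residue_mod)

lemma inverse_3_power_le_iff: "1 / 3 ^ a \<le> (1 / 3 ^ b :: real) \<longleftrightarrow> b \<le> a"
  by (simp add: divide_le_eq le_divide_eq)

instantiation padic3 :: metric_space
begin

text \<open>
  The exponent is the 3-adic valuation of \<open>x - y\<close>
  (see \<open>residue_eq_iff_dvd\<close> for the formulation in terms of divisibility).
\<close>

definition dist_padic3 :: "padic3 \<Rightarrow> padic3 \<Rightarrow> real" where
  "dist_padic3 x y = (if x = y then 0 else 1 / 3 ^ (GREATEST j. 3 ^ j dvd x - y))"

definition uniformity_padic3 :: "(padic3 \<times> padic3) filter" where
  "uniformity_padic3 = (INF e\<in>{0<..}. principal {(x, y). dist x y < e})"

definition open_padic3 :: "padic3 set \<Rightarrow> bool" where
  "open_padic3 U = (\<forall>x\<in>U. eventually (\<lambda>(x', y). x' = x \<longrightarrow> y \<in> U) uniformity)"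

lemma dist_padic3_le_iff: "dist x y \<le> 1 / 3 ^ j \<longleftrightarrow> residue x j = residue y j"
  for x y :: padic3
proof (cases "x = y")
  case True
  then show ?thesis by (simp add: dist_padic3_def)
next
  case False
  let ?P = "\<lambda>j. 3 ^ j dvd x - y"
  let ?v = "Greatest ?P"
  obtain n where n: "residue x n \<noteq> residue y n" using False padic3_eqI by blast
  have bd: "i \<le> n" if "?P i" for i
  proof (rule ccontr)
    assume "\<not> i \<le> n"
    moreover have "residue x i = residue y i" using that by (simp only: residue_eq_iff_dvd)
    ultimately show False using n residue_eq_mono[of x i y n] by simp
  qed
  have P0: "?P 0" by simp
  have Pv: "?P ?v" using bd by (intro GreatestI_nat[of ?P 0 n] P0) blast
  have "j \<le> ?v \<longleftrightarrow> ?P j"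
  proof
    assume "j \<le> ?v"
    moreover have "residue x ?v = residue y ?v" using Pv by (simp only: residue_eq_iff_dvd)
    ultimately show "?P j" using residue_eq_mono residue_eq_iff_dvd by blast
  next
    assume "?P j"
    then show "j \<le> ?v" using bd by (intro Greatest_le_nat[of ?P j n]) blast+
  qed
  moreover have "dist x y \<le> 1 / 3 ^ j \<longleftrightarrow> j \<le> ?v"
    using False by (simp only: dist_padic3_def inverse_3_power_le_iff if_False)
  ultimately show ?thesis by (simp add: residue_eq_iff_dvd)
qed

instance
proof
  fix x y z :: padic3
  show "uniformity = (INF e\<in>{0<..}. principal {(x::padic3, y). dist x y < e})"
    by (rule uniformity_padic3_def)
  show "open U = (\<forall>x\<in>U. eventually (\<lambda>(x', y). x' = x \<longrightarrow> y \<in> U) uniformity)"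
    for U :: "padic3 set" by (rule open_padic3_def)
  show "dist x y = 0 \<longleftrightarrow> x = y" by (simp add: dist_padic3_def)
  have nn: "0 \<le> dist a b" for a b :: padic3 by (simp add: dist_padic3_def)
  have ultra: "dist x y \<le> max (dist x z) (dist y z)"
  proof (cases "x = z \<or> y = z")
    case True
    then show ?thesis
    proof
      assume "y = z" then show ?thesis by simp
    next
      assume "x = z"
      moreover have "dist z y = dist y z"
      proof -
        have "3 ^ k dvd z - y \<longleftrightarrow> 3 ^ k dvd y - z" for k
          by (simp only: residue_eq_iff_dvd[symmetric] eq_commute)
        then show ?thesis by (simp add: dist_padic3_def eq_commute[of z y])
      qed
      ultimately show ?thesis by simp
    qed
  next
    case False
    obtain i where i: "dist x z = 1 / 3 ^ i" using False by (auto simp: dist_padic3_def)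
    obtain j where j: "dist y z = 1 / 3 ^ j" using False by (auto simp: dist_padic3_def)
    have "residue x i = residue z i" "residue y j = residue z j"
      by (rule dist_padic3_le_iff[THEN iffD1], simp add: i,
          rule dist_padic3_le_iff[THEN iffD1], simp add: j)
    then have "residue x (min i j) = residue y (min i j)"
      using residue_eq_mono[of x i z "min i j"] residue_eq_mono[of y j z "min i j"] by simp
    then have "dist x y \<le> 1 / 3 ^ min i j" by (simp add: dist_padic3_le_iff)
    then show ?thesis unfolding i j
      by (auto simp: min_def max_def inverse_3_power_le_iff split: if_splits)
  qed
  also have "\<dots> \<le> dist x z + dist y z" using nn[of x z] nn[of y z] by auto
  finally show "dist x y \<le> dist x z + dist y z" .
qed

end

lemma diameter_residue_class: "diameter {y. residue y j = residue x j} = 1 / 3 ^ j"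
proof -
  let ?C = "{y. residue y j = residue x j}"
  let ?y = "x + of_int (3 ^ j)"
  have y: "?y \<in> ?C" by (simp only: residue_ops residue_of_int mod_simps mem_Collect_eq) simp
  have le: "dist a b \<le> 1 / 3 ^ j" if "a \<in> ?C" "b \<in> ?C" for a b
    using that by (simp add: dist_padic3_le_iff)
  have "residue x (Suc j) \<noteq> residue ?y (Suc j)"
  proof
    assume "residue x (Suc j) = residue ?y (Suc j)"
    then have "residue (?y - x) (Suc j) = 0"
      by (simp only: minus_padic3.rep_eq diff_self mod_0)
    then have "residue (of_int (3 ^ j)) (Suc j) = 0" by simp
    then show False unfolding residue_of_int by simp
  qed
  then have "?y \<noteq> x" "\<not> dist x ?y \<le> 1 / 3 ^ Suc j" using dist_padic3_le_iff by metis+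
  moreover obtain i where i: "dist x ?y = 1 / 3 ^ i"
    using \<open>?y \<noteq> x\<close> unfolding dist_padic3_def by metis
  ultimately have "\<not> Suc j \<le> i" by (simp only: inverse_3_power_le_iff) simp
  then have ge: "1 / 3 ^ j \<le> dist x ?y" unfolding i inverse_3_power_le_iff by simp
  have bdd: "bounded ?C" unfolding bounded_def
    by (rule exI[of _ x], rule exI[of _ "1 / 3 ^ j"], intro ballI le) simp_all
  show ?thesis
  proof (rule antisym)
    show "diameter ?C \<le> 1 / 3 ^ j" unfolding diameter_def using y le by (auto intro!: cSUP_least)
    show "1 / 3 ^ j \<le> diameter ?C"
      using ge diameter_bounded_bound[OF bdd _ y, of x] by simp
  qed
qed


section \<open>3-adic expansions\<close>

definition is_expansion :: "padic3 \<Rightarrow> (nat \<Rightarrow> nat) \<Rightarrow> bool" where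
  "is_expansion x d \<longleftrightarrow> (\<forall>j. d j \<in> {0, 1, 2}) \<and> (\<lambda>j. of_nat (d j) * 3 ^ j) sums x"

lemma sums_padic3_iff:
  fixes d :: "nat \<Rightarrow> nat"
  shows "(\<lambda>j. of_nat (d j) * 3 ^ j) sums x \<longleftrightarrow>
    (\<forall>n. residue x n = int (\<Sum>j<n. d j * 3 ^ j) mod 3 ^ n)"
proof -
  define S where "S n = (\<Sum>j<n. d j * 3 ^ j)" for n
  have S: "(\<Sum>j<n. of_nat (d j) * 3 ^ j) = (of_nat (S n) :: padic3)" for n
    by (simp add: S_def)
  have stab: "int (S m) mod 3 ^ n = int (S n) mod 3 ^ n" if "n \<le> m" for m n
    using that
  proof (induction m rule: dec_induct)
    case (step m)
    have "(3::int) ^ n dvd int (d m) * 3 ^ m"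
      using step by (intro dvd_mult le_imp_power_dvd) simp
    then have "(int (S m) + int (d m) * 3 ^ m) mod 3 ^ n = int (S m) mod 3 ^ n"
      by (subst mod_add_right_eq[symmetric]) (simp add: dvd_imp_mod_0)
    then show ?case using step by (simp add: S_def)
  qed simp
  have "(\<lambda>j. of_nat (d j) * 3 ^ j) sums x \<longleftrightarrow> (\<lambda>n. of_nat (S n)) \<longlonglongrightarrow> x"
    by (simp add: sums_def S)
  also have "\<dots> \<longleftrightarrow> (\<forall>n. residue x n = int (S n) mod 3 ^ n)"
  proof
    assume lim: "(\<lambda>n. of_nat (S n)) \<longlonglongrightarrow> x"
    show "\<forall>n. residue x n = int (S n) mod 3 ^ n"
    proof
      fix n
      have "eventually (\<lambda>m. dist (of_nat (S m)) x < 1 / 3 ^ n) sequentially"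
        using lim by (rule tendstoD) simp
      then obtain M where M: "\<And>m. m \<ge> M \<Longrightarrow> dist (of_nat (S m)) x < 1 / 3 ^ n"
        by (auto simp: eventually_sequentially)
      have "dist (of_nat (S (max M n))) x \<le> 1 / 3 ^ n" using M[of "max M n"] by simp
      then have "residue (of_nat (S (max M n))) n = residue x n"
        by (simp only: dist_padic3_le_iff)
      then show "residue x n = int (S n) mod 3 ^ n"
        using stab[of n "max M n"] by (simp add: residue_of_nat)
    qed
  next
    assume eq: "\<forall>n. residue x n = int (S n) mod 3 ^ n"
    show "(\<lambda>n. of_nat (S n)) \<longlonglongrightarrow> x"
    proof (rule metric_LIMSEQ_I)
      fix r :: real assume "0 < r"
      then obtain n where n: "(1 / 3) ^ n < r"
        using real_arch_pow_inv[of r "1 / 3"] by auto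
      have "dist (of_nat (S m)) x < r" if "m \<ge> n" for m
      proof -
        have "residue (of_nat (S m)) n = residue x n"
          using stab[OF that] eq by (simp add: residue_of_nat)
        then have "dist (of_nat (S m)) x \<le> 1 / 3 ^ n" by (simp add: dist_padic3_le_iff)
        then show ?thesis using n by (simp add: power_one_over)
      qed
      then show "\<exists>n. \<forall>m\<ge>n. dist (of_nat (S m)) x < r" by blast
    qed
  qed
  finally show ?thesis by (simp add: S_def)
qed

lemma digit_sum_less:
  fixes d :: "nat \<Rightarrow> nat"
  assumes "\<And>j. d j \<in> {0, 1, 2}"
  shows "(\<Sum>j<n. d j * 3 ^ j) < 3 ^ n"
proof (induction n)
  case (Suc n)
  have "d n \<le> 2" using assms[of n] by auto
  then have "d n * 3 ^ n \<le> 2 * 3 ^ n" by simp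
  then show ?case using Suc unfolding sum.lessThan_Suc power_Suc by linarith
qed simp

lemma is_expansion_iff:
  "is_expansion x d \<longleftrightarrow>
    (\<forall>j. d j \<in> {0, 1, 2}) \<and> (\<forall>n. residue x n = int (\<Sum>j<n. d j * 3 ^ j))"
proof -
  have "int (\<Sum>j<n. d j * 3 ^ j) mod 3 ^ n = int (\<Sum>j<n. d j * 3 ^ j)"
    if "\<forall>j. d j \<in> {0, 1, 2}" for n
  proof (rule mod_pos_pos_trivial)
    have "(\<Sum>j<n. d j * 3 ^ j) < 3 ^ n" using that by (intro digit_sum_less) blast
    then show "int (\<Sum>j<n. d j * 3 ^ j) < 3 ^ n"
      by (metis of_nat_less_iff of_nat_numeral of_nat_power)
  qed (rule of_nat_0_le_iff)
  then show ?thesis unfolding is_expansion_def sums_padic3_iff by auto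
qed

lemma ex1_expansion: "\<exists>!d. is_expansion x d"
proof (rule ex_ex1I)
  define d where "d j = nat (residue x (Suc j) div 3 ^ j)" for j
  have dj: "int (d j) * 3 ^ j = residue x (Suc j) - residue x j" for j
  proof -
    have "int (d j) = residue x (Suc j) div 3 ^ j"
      using residue_nonneg[of x "Suc j"] by (simp add: d_def pos_imp_zdiv_nonneg_iff)
    then show ?thesis
      using minus_mod_eq_div_mult[of "residue x (Suc j)" "3 ^ j"] by (simp only: residue_Suc_mod)
  qed
  have "d j \<in> {0, 1, 2}" for j
  proof -
    have "int (d j) * 3 ^ j < 3 * 3 ^ j"
      using dj[of j] residue_less[of x "Suc j"] residue_nonneg[of x j] by simp
    then have "int (d j) < 3" by (rule mult_right_less_imp_less) simp
    then have "d j < 3" by simp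
    then show ?thesis by auto
  qed
  moreover have "residue x n = int (\<Sum>j<n. d j * 3 ^ j)" for n
    by (induction n) (simp_all add: dj)
  ultimately show "\<exists>d. is_expansion x d" unfolding is_expansion_iff by blast
next
  fix d e assume d: "is_expansion x d" and e: "is_expansion x e"
  show "d = e"
  proof
    fix j
    have "int (\<Sum>j<n. d j * 3 ^ j) = int (\<Sum>j<n. e j * 3 ^ j)" for n
      using d e unfolding is_expansion_iff by (blast intro: trans sym)
    then have "(\<Sum>j<n. d j * 3 ^ j) = (\<Sum>j<n. e j * 3 ^ j)" for n
      by (simp only: of_nat_eq_iff)
    from this[of j] this[of "Suc j"] show "d j = e j" by simp
  qed
qed

definition digit :: "padic3 \<Rightarrow> nat \<Rightarrow> nat" where
  "digit x = (THE d. is_expansion x d)"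

lemma is_expansion_digit: "is_expansion x (digit x)"
  unfolding digit_def using ex1_expansion by (rule theI')

definition omits_digit_2 :: "padic3 \<Rightarrow> bool" where
  "omits_digit_2 x \<longleftrightarrow> (\<forall>j. digit x j \<in> {0, 1})"

text \<open>
  Membership for ``at least \<open>k\<close>'' exponents is witnessed by a set of exactly \<open>k\<close> of them,
  since \<^const>\<open>card\<close> is 0 on infinite sets.
\<close>

definition exceptional_set :: "nat \<Rightarrow> padic3 set" where
  "exceptional_set k =
    {l. \<exists>N :: nat set. finite N \<and> card N = k \<and> (\<forall>n\<in>N. omits_digit_2 (l * 2 ^ n))}"


section \<open>Hausdorff dimension\<close>

text \<open>
  The summand \<open>diam U ^ s\<close> with the usual conventions for the degenerate cases: the empty set
  contributes 0, and \<open>0 ^ 0 = 1\<close> (whereas \<open>0 powr 0 = 0\<close>).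
\<close>

definition diam_pow :: "real \<Rightarrow> 'a :: metric_space set \<Rightarrow> ennreal" where
  "diam_pow s U =
    (if U = {} then 0 else if s = 0 then 1 else ennreal (diameter U powr s))"

text \<open>
  Boundedness of the covering sets is required because \<^const>\<open>diameter\<close> is only meaningful
  for bounded sets.
\<close>

definition hausdorff_premeasure :: "real \<Rightarrow> real \<Rightarrow> 'a :: metric_space set \<Rightarrow> ennreal" where
  "hausdorff_premeasure s \<delta> A =
    (INF U \<in> {U :: nat \<Rightarrow> 'a set.
        A \<subseteq> (\<Union>i. U i) \<and> (\<forall>i. bounded (U i) \<and> diameter (U i) \<le> \<delta>)}.
      \<Sum>i. diam_pow s (U i))"

definition hausdorff_measure :: "real \<Rightarrow> 'a :: metric_space set \<Rightarrow> ennreal" where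
  "hausdorff_measure s A = (SUP \<delta> \<in> {0<..}. hausdorff_premeasure s \<delta> A)"

definition hausdorff_dim :: "'a :: metric_space set \<Rightarrow> ereal" where
  "hausdorff_dim A = Inf {ereal s | s. 0 \<le> s \<and> hausdorff_measure s A = 0}"

end

theory Submission
  imports Defs
begin

text \<open>
  For the upper bounds it suffices to count residues modulo powers of 3, since each exceptional
  set is a countable union over exponents and powers of 2 are units. Suppose \<open>x\<close> and \<open>M x\<close> both
  omit the digit 2, where \<open>M\<close> is a power of 2. For \<open>M\<close> congruent to 2 modulo 3, the lowest nonzero
  digit forces \<open>x = 0\<close>. Otherwise write \<open>M - 1 = 3\<^sup>m u\<close> with \<open>u\<close> prime to 3 and \<open>m > 0\<close>. The digitwise
  differences of \<open>M x\<close> and \<open>x\<close> are the balanced ternary digits of \<open>(M - 1) x\<close>, so the digit of \<open>x\<close>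
  in position \<open>n + m\<close> is free only if the balanced digit there vanishes; as that digit depends on
  \<open>d\<^sub>n\<close> through \<open>u d\<^sub>n\<close> modulo 3, at most one value of \<open>d\<^sub>n\<close> allows it. Hence each pair of digits
  in positions \<open>n\<close> and \<open>n + m\<close> takes at most 3 values once the digits below \<open>n\<close> are known, which gives
  at most \<open>3\<^sup>L\<close> residues modulo \<open>9\<^sup>L\<close>.

  The lower bounds come from the numbers whose digits are 0 or 1, with the digit 1 only in positions
  divisible by \<open>k\<close>. These omit the digit 2, and multiplication by a number below \<open>3\<^sup>k\<close> that omits
  the digit 2 produces no carries: \<open>4 = (11)\<^sub>3\<close> works for \<open>k = 2\<close>, and both 4 and
  \<open>256 = (100111)\<^sub>3\<close> work for \<open>k = 6\<close>.
\<close>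

section \<open>Digits, residues and units modulo powers of 3\<close>

lemma digit_eqI: "is_expansion x d \<Longrightarrow> digit x = d"
  using ex1_expansion is_expansion_digit by blast

lemma digit_range: "digit x j \<in> {0, 1, 2}"
  using is_expansion_digit[of x] unfolding is_expansion_iff by blast

lemma residue_eq_sum_digit: "residue x n = (\<Sum>j<n. int (digit x j) * 3 ^ j)"
  using is_expansion_digit[of x] unfolding is_expansion_iff by simp

lemma residue_Suc_digit: "residue x (Suc n) = residue x n + int (digit x n) * 3 ^ n"
  by (simp add: residue_eq_sum_digit)

lemma residue_eq_iff_digit: "residue x n = residue y n \<longleftrightarrow> (\<forall>j<n. digit x j = digit y j)"
proof
  assume *: "residue x n = residue y n"
  show "\<forall>j<n. digit x j = digit y j"
  proof (intro allI impI)
    fix j assume "j < n"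
    then have "residue x j = residue y j" "residue x (Suc j) = residue y (Suc j)"
      using residue_eq_mono[OF *] by simp_all
    then show "digit x j = digit y j" by (simp add: residue_Suc_digit)
  qed
qed (simp add: residue_eq_sum_digit)

text \<open>The first \<open>n\<close> terms sum to less than \<open>3 ^ n\<close>, so the partial
  sums already form a coherent sequence of residues.\<close>

lemma ex_expansion:
  assumes "\<And>j. d j \<in> {0, 1, 2}"
  shows "\<exists>x. is_expansion x d"
proof -
  define S where "S n = int (\<Sum>j<n. d j * 3 ^ j)" for n
  have bd: "0 \<le> S n" "S n < 3 ^ n" for n
  proof -
    show "0 \<le> S n" by (simp add: S_def del: of_nat_sum)
    have "(\<Sum>j<n. d j * 3 ^ j) < 3 ^ n" using assms by (rule digit_sum_less)
    then have "int (\<Sum>j<n. d j * 3 ^ j) < int (3 ^ n)" by (simp only: of_nat_less_iff)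
    then show "S n < 3 ^ n" by (simp add: S_def)
  qed
  have "S n = S (Suc n) mod 3 ^ n" for n
  proof -
    have "S (Suc n) = S n + int (d n) * 3 ^ n" by (simp add: S_def)
    then show ?thesis using bd[of n] by simp
  qed
  then have "residue (Abs_padic3 S) = S"
    by (intro Abs_padic3_inverse, unfold mem_Collect_eq) (rule allI)
  then have "is_expansion (Abs_padic3 S) d"
    using assms unfolding is_expansion_iff by (simp add: S_def)
  then show ?thesis by blast
qed

lemma residue_mult_of_nat: "residue (x * of_nat M) n = residue x n * int M mod 3 ^ n"
  by (simp add: residue_ops residue_of_nat mod_simps)

lemma residue_eq_if_dvd:
  assumes "3 ^ n dvd residue x n - residue y n"
  shows "residue x n = residue y n"
proof -
  have "residue x n mod 3 ^ n = residue y n mod 3 ^ n"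
    using assms by (simp only: mod_eq_dvd_iff)
  then show ?thesis by simp
qed

lemma residue_mult_cancel:
  assumes "coprime M 3" "residue (x * of_nat M) n = residue (y * of_nat M) n"
  shows "residue x n = residue y n"
proof (rule residue_eq_if_dvd)
  have "3 ^ n dvd (residue x n - residue y n) * int M"
    using assms(2) by (simp add: residue_mult_of_nat mod_eq_dvd_iff left_diff_distrib)
  moreover have "coprime (3 ^ n) (int M)"
    using assms(1) by (metis coprime_commute coprime_int_iff coprime_power_left_iff of_nat_numeral)
  ultimately show "3 ^ n dvd residue x n - residue y n"
    by (simp add: coprime_dvd_mult_left_iff)
qed

section \<open>Balanced ternary digits and counting by prefixes\<close>

text \<open>Induction settles the lower digits; then 3 divides \<open>s n - t n\<close>, whose
  absolute value is at most 2.\<close>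

lemma balanced_ternary_unique:
  fixes s t :: "nat \<Rightarrow> int"
  assumes "\<And>i. s i \<in> {-1, 0, 1}" "\<And>i. t i \<in> {-1, 0, 1}"
    and "3 ^ n dvd (\<Sum>i<n. s i * 3 ^ i) - (\<Sum>i<n. t i * 3 ^ i)"
  shows "\<forall>i<n. s i = t i"
  using assms(3)
proof (induction n)
  case (Suc n)
  let ?S = "\<Sum>i<n. s i * 3 ^ i" and ?T = "\<Sum>i<n. t i * 3 ^ i"
  have d: "3 ^ Suc n dvd (?S - ?T) + (s n - t n) * 3 ^ n"
    using Suc.prems by (simp add: algebra_simps)
  have "3 ^ n dvd (?S - ?T) + (s n - t n) * 3 ^ n"
    using d by (rule dvd_trans[rotated]) simp
  then have "3 ^ n dvd ?S - ?T" by (simp add: dvd_add_left_iff)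
  with Suc.IH have IH: "\<forall>i<n. s i = t i" by blast
  then have "?S = ?T" by simp
  with d have "3 * 3 ^ n dvd (s n - t n) * 3 ^ n" by simp
  then have "3 dvd s n - t n" by (simp only: dvd_mult_cancel_right) simp
  then have "s n = t n" using assms(1)[of n] assms(2)[of n] by auto
  with IH show ?case by (simp add: less_Suc_eq)
qed simp

text \<open>Nodes of a tree are counted level by level, each prefix having at most \<open>c\<close>
  continuations. It serves single digits with \<open>c = 2\<close> and pairs of digits with
  \<open>c = 3\<close>.\<close>

lemma card_image_prefix_le:
  fixes f :: "nat \<Rightarrow> 'a \<Rightarrow> 'b"
  assumes "\<And>j x. x \<in> X \<Longrightarrow>
      finite {f j y | y. y \<in> X \<and> (\<forall>i<j. f i y = f i x)} \<and>
      card {f j y | y. y \<in> X \<and> (\<forall>i<j. f i y = f i x)} \<le> c"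
  shows "finite ((\<lambda>x. map (\<lambda>j. f j x) [0..<n]) ` X) \<and>
    card ((\<lambda>x. map (\<lambda>j. f j x) [0..<n]) ` X) \<le> c ^ n"
proof (induction n)
  case 0
  show ?case by (auto simp: image_constant_conv)
next
  case (Suc n)
  define F where "F n x = map (\<lambda>j. f j x) [0..<n]" for n x
  define B where "B v = {f n y | y. y \<in> X \<and> F n y = v}" for v
  have IH: "finite (F n ` X)" "card (F n ` X) \<le> c ^ n" using Suc by (simp_all add: F_def)
  have B: "finite (B v) \<and> card (B v) \<le> c" if v: "v \<in> F n ` X" for v
  proof -
    from v obtain x where x: "x \<in> X" "v = F n x" by blast
    have "B v = {f n y | y. y \<in> X \<and> (\<forall>i<n. f i y = f i x)}"
      unfolding B_def x(2) F_def by (auto simp: map_eq_conv)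
    with assms[OF x(1), of n] show ?thesis by simp
  qed
  have sub: "F (Suc n) ` X \<subseteq> (\<Union>v\<in>F n ` X. (\<lambda>w. v @ [w]) ` B v)"
    by (auto simp: F_def B_def)
  have fin: "finite (\<Union>v\<in>F n ` X. (\<lambda>w. v @ [w]) ` B v)" using IH B by blast
  have "card (F (Suc n) ` X) \<le> card (\<Union>v\<in>F n ` X. (\<lambda>w. v @ [w]) ` B v)"
    using sub fin by (rule card_mono[rotated])
  also have "\<dots> \<le> (\<Sum>v\<in>F n ` X. card ((\<lambda>w. v @ [w]) ` B v))" using IH(1) by (rule card_UN_le)
  also have "\<dots> \<le> (\<Sum>v\<in>F n ` X. c)"
    using B card_image_le order_trans by (intro sum_mono) blast
  also have "\<dots> \<le> c ^ n * c" using IH(2) by simp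
  finally show ?case using finite_subset[OF sub fin] by (simp add: F_def mult.commute)
qed

text \<open>On \<open>X\<close> the map \<open>g\<close> factors through \<open>f\<close>; the
  factor is evaluated at a chosen preimage.\<close>

lemma card_image_le_of_factor:
  assumes "finite (f ` X)" "\<And>x y. x \<in> X \<Longrightarrow> y \<in> X \<Longrightarrow> f x = f y \<Longrightarrow> g x = g y"
  shows "finite (g ` X) \<and> card (g ` X) \<le> card (f ` X)"
proof -
  let ?h = "\<lambda>v. g (SOME x. x \<in> X \<and> f x = v)"
  have sub: "g ` X \<subseteq> ?h ` f ` X"
  proof
    fix w assume "w \<in> g ` X"
    then obtain x where x: "x \<in> X" "w = g x" by blast
    let ?y = "SOME y. y \<in> X \<and> f y = f x"
    have y: "?y \<in> X \<and> f ?y = f x" by (rule someI[of _ x]) (simp add: x(1))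
    have "g x = g ?y" by (rule assms(2)[OF x(1) conjunct1[OF y] conjunct2[OF y, symmetric]])
    then have "w = g ?y" using x(2) by (rule trans[rotated])
    then show "w \<in> (\<lambda>v. g (SOME x. x \<in> X \<and> f x = v)) ` f ` X" using x by blast
  qed
  show ?thesis
    using finite_subset[OF sub finite_imageI[OF assms(1)]] surj_card_le[OF assms(1) sub] by simp
qed

lemma finite_residues: "finite ((\<lambda>x. residue x n) ` A)"
  by (rule finite_subset[of _ "{0..<3 ^ n}"]) (auto simp: residue_nonneg residue_less)

lemma card_residues_omits:
  assumes "\<And>x. x \<in> A \<Longrightarrow> omits_digit_2 x"
  shows "card ((\<lambda>x. residue x n) ` A) \<le> 2 ^ n"
proof -
  have "finite {digit y j | y. y \<in> A \<and> (\<forall>i<j. digit y i = digit x i)} \<and>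
      card {digit y j | y. y \<in> A \<and> (\<forall>i<j. digit y i = digit x i)} \<le> 2" for j x
  proof -
    have sub: "{digit y j | y. y \<in> A \<and> (\<forall>i<j. digit y i = digit x i)} \<subseteq> {0, 1}"
    proof
      fix w assume "w \<in> {digit y j | y. y \<in> A \<and> (\<forall>i<j. digit y i = digit x i)}"
      then obtain y where y: "y \<in> A" "w = digit y j" by blast
      then have "digit y j \<in> {0, 1}" using assms[of y] unfolding omits_digit_2_def by blast
      with y(2) show "w \<in> {0, 1}" by (simp only:)
    qed
    have fin: "finite {0, 1 :: nat}" "card {0, 1 :: nat} \<le> 2" by simp_all
    show ?thesis
      by (intro conjI finite_subset[OF sub fin(1)] order_trans[OF card_mono[OF fin(1) sub] fin(2)])
  qed
  then have *: "finite ((\<lambda>x. map (\<lambda>j. digit x j) [0..<n]) ` A) \<and>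
      card ((\<lambda>x. map (\<lambda>j. digit x j) [0..<n]) ` A) \<le> 2 ^ n"
    by (intro card_image_prefix_le)
  have "card ((\<lambda>x. residue x n) ` A) \<le> card ((\<lambda>x. map (\<lambda>j. digit x j) [0..<n]) ` A)"
    using * by (intro card_image_le_of_factor[THEN conjunct2]) (auto simp: residue_eq_iff_digit)
  with * show ?thesis by simp
qed

section \<open>Numbers that omit the digit 2 together with their multiple by
  \<open>M\<close>\<close>

definition both_omit :: "nat \<Rightarrow> padic3 set" where
  "both_omit M = {x. omits_digit_2 x \<and> omits_digit_2 (x * of_nat M)}"

text \<open>
  For \<open>x \<in> both_omit M\<close> the numbers \<open>r\<^sub>i - d\<^sub>i\<close>, with \<open>d\<close> and \<open>r\<close> the digits of \<open>x\<close> and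
  \<open>M x\<close>, are the balanced ternary digits of \<open>(M - 1) x\<close>; a nonzero one determines \<open>d\<^sub>i\<close>.
\<close>

definition digit_diff :: "nat \<Rightarrow> padic3 \<Rightarrow> nat \<Rightarrow> int" where
  "digit_diff M x i = int (digit (x * of_nat M) i) - int (digit x i)"

lemma digit_diff_range: "x \<in> both_omit M \<Longrightarrow> digit_diff M x i \<in> {-1, 0, 1}"
proof -
  assume "x \<in> both_omit M"
  then have "digit x i \<in> {0, 1}" "digit (x * of_nat M) i \<in> {0, 1}"
    unfolding both_omit_def omits_digit_2_def by blast+
  then show ?thesis unfolding digit_diff_def by auto
qed

lemma sum_digit_diff: "3 ^ n dvd (\<Sum>i<n. digit_diff M x i * 3 ^ i) - (int M - 1) * residue x n"
proof -
  have "(\<Sum>i<n. digit_diff M x i * 3 ^ i) = residue (x * of_nat M) n - residue x n"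
    by (simp add: digit_diff_def residue_eq_sum_digit left_diff_distrib sum_subtractf)
  moreover have "3 ^ n dvd residue (x * of_nat M) n - residue x n * int M"
    unfolding residue_mult_of_nat by (metis dvd_minus_mod minus_diff_eq dvd_minus_iff)
  ultimately show ?thesis by (simp add: algebra_simps)
qed

text \<open>The factor \<open>3 ^ m\<close> of \<open>M - 1\<close> lifts the congruence of
  \<open>x\<close> and \<open>y\<close> modulo \<open>3 ^ n\<close> to one of their multiples by
  \<open>M - 1\<close> modulo \<open>3 ^ (n + m)\<close>, and balanced digits are unique.\<close>

lemma digit_diff_eq:
  assumes "x \<in> both_omit M" "y \<in> both_omit M" "residue x n = residue y n"
    and M: "int M - 1 = 3 ^ m * u" and i: "i < n + m"
  shows "digit_diff M x i = digit_diff M y i"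
proof -
  let ?N = "n + m"
  have "residue x ?N mod 3 ^ n = residue y ?N mod 3 ^ n" using assms(3) by (simp add: residue_mod)
  then have "3 ^ n dvd residue x ?N - residue y ?N" by (simp add: mod_eq_dvd_iff)
  then have "3 ^ m * 3 ^ n dvd (3 ^ m * u) * (residue x ?N - residue y ?N)"
    by (intro mult_dvd_mono) simp_all
  then have c: "3 ^ ?N dvd (int M - 1) * residue x ?N - (int M - 1) * residue y ?N"
    by (simp add: M power_add mult.commute right_diff_distrib)
  have "3 ^ ?N dvd (\<Sum>i<?N. digit_diff M x i * 3 ^ i) - (\<Sum>i<?N. digit_diff M y i * 3 ^ i)"
    using dvd_diff[OF dvd_add[OF sum_digit_diff[of ?N M x] c] sum_digit_diff[of ?N M y]]
    by (simp add: algebra_simps)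
  from balanced_ternary_unique[OF digit_diff_range digit_diff_range this] assms i
  show ?thesis by blast
qed

text \<open>Agreement of the balanced digits up to position \<open>n + m\<close> makes the multiples
  by \<open>M - 1\<close> congruent modulo \<open>3 ^ (Suc n + m)\<close>; cancelling
  \<open>3 ^ m\<close> and the unit \<open>u\<close> leaves one more digit of
  \<open>x\<close>.\<close>

lemma digit_diff_determines_digit:
  assumes "x \<in> both_omit M" "y \<in> both_omit M" "residue x n = residue y n"
    and M: "int M - 1 = 3 ^ m * u" and u: "\<not> 3 dvd u"
    and eq: "digit_diff M x (n + m) = digit_diff M y (n + m)"
  shows "digit x n = digit y n"
proof -
  let ?N = "Suc n + m"
  have "digit_diff M x i = digit_diff M y i" if "i < ?N" for i
    using digit_diff_eq[OF assms(1-3) M, of i] eq that by (cases "i = n + m") simp_all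
  then have "(\<Sum>i<?N. digit_diff M x i * 3 ^ i) = (\<Sum>i<?N. digit_diff M y i * 3 ^ i)" by simp
  then have "3 ^ ?N dvd (int M - 1) * residue x ?N - (int M - 1) * residue y ?N"
    using dvd_diff[OF sum_digit_diff[of ?N M y] sum_digit_diff[of ?N M x]]
    by (simp add: algebra_simps)
  then have "3 ^ m * 3 ^ Suc n dvd 3 ^ m * (u * (residue x ?N - residue y ?N))"
    unfolding M power_add by (simp add: algebra_simps)
  then have "3 ^ Suc n dvd u * (residue x ?N - residue y ?N)"
    by (simp only: dvd_mult_cancel_left) simp
  moreover have "coprime (3 ^ Suc n) u"
    using u prime_imp_coprime[of 3 u] by (simp add: coprime_power_left_iff)
  ultimately have "3 ^ Suc n dvd residue x ?N - residue y ?N"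
    by (simp only: coprime_dvd_mult_right_iff)
  then have "residue x ?N mod 3 ^ Suc n = residue y ?N mod 3 ^ Suc n"
    by (simp only: mod_eq_dvd_iff)
  then have "residue x (Suc n) = residue y (Suc n)" using residue_mod[of "Suc n" ?N] by simp
  then show ?thesis unfolding residue_eq_iff_digit by simp
qed

text \<open>If all four pairs occurred, both values of the digit at \<open>n\<close> would come with
  balanced digit 0 at \<open>n + m\<close>; but given the residue, that balanced digit determines
  the digit at \<open>n\<close>.\<close>

lemma card_digit_pairs:
  fixes n :: nat and r :: int
  assumes M: "int M - 1 = 3 ^ m * u" and u: "\<not> 3 dvd u"
  defines "P \<equiv> {(digit y n, digit y (n + m)) | y. y \<in> both_omit M \<and> residue y n = r}"
  shows "finite P \<and> card P \<le> 3"
proof -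
  let ?Q = "{0, 1 :: nat} \<times> {0, 1 :: nat}"
  have sub: "P \<subseteq> ?Q" unfolding P_def both_omit_def omits_digit_2_def by blast
  have "P \<noteq> ?Q"
  proof
    assume all: "P = ?Q"
    have "\<exists>y \<in> both_omit M. residue y n = r \<and> digit y n = a \<and> digit_diff M y (n + m) = 0"
      if "a \<in> {0, 1}" for a
    proof -
      have "(a, 0) \<in> P" "(a, 1) \<in> P" using all that by auto
      then obtain y z where y: "y \<in> both_omit M" "residue y n = r" "digit y n = a"
          "digit y (n + m) = 0"
        and z: "z \<in> both_omit M" "residue z n = r" "digit z n = a" "digit z (n + m) = 1"
        unfolding P_def by auto
      \<comment> \<open>So \<open>y\<close> and \<open>z\<close> share the balanced digit at
        \<open>n + m\<close>: it is nonnegative since \<open>y\<close> has digit 0 there, and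
        nonpositive since \<open>z\<close> has digit 1.\<close>
      have "residue y (Suc n) = residue z (Suc n)" using y z by (simp add: residue_Suc_digit)
      then have "digit_diff M y (n + m) = digit_diff M z (n + m)"
        using digit_diff_eq[OF y(1) z(1) _ M, of "Suc n" "n + m"] by simp
      moreover have "digit_diff M y (n + m) \<ge> 0" using y(4) by (simp add: digit_diff_def)
      moreover have "digit (z * of_nat M) (n + m) \<in> {0, 1}"
        using z(1) unfolding both_omit_def omits_digit_2_def by blast
      then have "digit_diff M z (n + m) \<le> 0" using z(4) unfolding digit_diff_def by auto
      ultimately show ?thesis using y by auto
    qed
    from this[of 0] this[of 1] obtain y z where
      "y \<in> both_omit M" "residue y n = r" "digit y n = 0" "digit_diff M y (n + m) = 0"
      "z \<in> both_omit M" "residue z n = r" "digit z n = 1" "digit_diff M z (n + m) = 0" by auto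
    then show False using digit_diff_determines_digit[OF _ _ _ M u, of y z n] by simp
  qed
  have "card P < card ?Q" by (rule psubset_card_mono[OF _ psubsetI[OF sub \<open>P \<noteq> ?Q\<close>]]) simp
  also have "card ?Q = 4" by (simp add: card_cartesian_product)
  finally show ?thesis using finite_subset[OF sub] by simp
qed

text \<open>Blocks of \<open>2 * m\<close> positions split into \<open>m\<close> pairs at distance
  \<open>m\<close>; this makes \<open>m * k\<close> pairs, each with at most 3 values given the
  earlier ones.\<close>

lemma card_residues_both_omit:
  assumes M: "int M - 1 = 3 ^ m * u" and u: "\<not> 3 dvd u" and m: "m > 0"
  shows "card ((\<lambda>x. residue x (2 * m * k)) ` both_omit M) \<le> 3 ^ (m * k)"
proof -
  \<comment> \<open>\<open>p\<close> lists the positions in the first halves of the blocks in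
    increasing order; the partner of \<open>p i\<close> is \<open>p i + m\<close>.\<close>
  define p where "p i = 2 * m * (i div m) + i mod m" for i
  define f where "f i x = (digit x (p i), digit x (p i + m))" for i x
  \<comment> \<open>A position below \<open>p i\<close> is \<open>p j\<close> or
    \<open>p j + m\<close> for some \<open>j\<close>, and monotonicity of \<open>p\<close> gives
    \<open>j < i\<close>. Hence the earlier pairs fix the residue that
    \<open>card_digit_pairs\<close> asks for.\<close>
  have agree: "residue x (p i) = residue y (p i)" if "\<forall>j<i. f j x = f j y" for x y i
    unfolding residue_eq_iff_digit
  proof (intro allI impI)
    fix l assume l: "l < p i"
    define q where "q = l div (2 * m)"
    define r where "r = l mod (2 * m)"
    have lqr: "l = 2 * m * q + r" "r < 2 * m" using m by (simp_all add: q_def r_def)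
    define j where "j = m * q + r mod m"
    have pj: "p j = 2 * m * q + r mod m" using m by (simp add: p_def j_def)
    have l_cases: "l = p j \<or> l = p j + m"
    proof (cases "r < m")
      case False
      then have "r mod m = r - m" using lqr(2) by (simp add: mod_if)
      then show ?thesis using False pj lqr by simp
    qed (use pj lqr in simp)
    have "j < i"
    proof (rule ccontr)
      assume "\<not> j < i"
      then have "i \<le> j" by simp
      have "p i \<le> p j"
      proof (cases "i div m = j div m")
        case True
        then have "i div m * m = j div m * m" by simp
        then have "i mod m \<le> j mod m"
          using \<open>i \<le> j\<close> div_mult_mod_eq[of i m] div_mult_mod_eq[of j m] by linarith
        then show ?thesis unfolding p_def True by simp
      next
        case False
        then have "Suc (i div m) \<le> j div m" using div_le_mono[OF \<open>i \<le> j\<close>, of m] by simp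
        then have "2 * m * Suc (i div m) \<le> 2 * m * (j div m)" by (rule mult_le_mono2)
        moreover have "i mod m < m" using m by simp
        ultimately show ?thesis unfolding p_def mult_Suc_right by linarith
      qed
      with l l_cases show False by auto
    qed
    with that have "f j x = f j y" by blast
    with l_cases show "digit x l = digit y l" unfolding f_def by auto
  qed
  have "finite {f j y | y. y \<in> both_omit M \<and> (\<forall>i<j. f i y = f i x)} \<and>
      card {f j y | y. y \<in> both_omit M \<and> (\<forall>i<j. f i y = f i x)} \<le> 3" for j x
  proof -
    let ?P = "{(digit y (p j), digit y (p j + m)) | y.
      y \<in> both_omit M \<and> residue y (p j) = residue x (p j)}"
    have sub: "{f j y | y. y \<in> both_omit M \<and> (\<forall>i<j. f i y = f i x)} \<subseteq> ?P"
    proof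
      fix w assume "w \<in> {f j y | y. y \<in> both_omit M \<and> (\<forall>i<j. f i y = f i x)}"
      then obtain y where y: "y \<in> both_omit M" "\<forall>i<j. f i y = f i x" "w = f j y" by blast
      then have "w = (digit y (p j), digit y (p j + m))" by (simp only: f_def)
      with y(1) agree[OF y(2)] show "w \<in> ?P" by blast
    qed
    have P: "finite ?P" "card ?P \<le> 3"
      using card_digit_pairs[OF M u, of "p j" "residue x (p j)"] by (simp_all only:)
    show ?thesis
      by (intro conjI finite_subset[OF sub P(1)] order_trans[OF card_mono[OF P(1) sub] P(2)])
  qed
  then have *: "finite ((\<lambda>x. map (\<lambda>j. f j x) [0..<m * k]) ` both_omit M) \<and>
      card ((\<lambda>x. map (\<lambda>j. f j x) [0..<m * k]) ` both_omit M) \<le> 3 ^ (m * k)"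
    by (intro card_image_prefix_le)
  \<comment> \<open>Here \<open>p (m * k) = 2 * m * k\<close>, so all pairs together determine the
    residue.\<close>
  have "residue x (2 * m * k) = residue y (2 * m * k)"
    if "map (\<lambda>j. f j x) [0..<m * k] = map (\<lambda>j. f j y) [0..<m * k]" for x y
    using agree[of "m * k" x y] that m by (simp add: p_def)
  then have "card ((\<lambda>x. residue x (2 * m * k)) ` both_omit M) \<le>
      card ((\<lambda>x. map (\<lambda>j. f j x) [0..<m * k]) ` both_omit M)"
    using * by (intro card_image_le_of_factor[THEN conjunct2]) auto
  with * show ?thesis by simp
qed

text \<open>A first nonzero digit of \<open>x\<close> would be 1, and then \<open>M x\<close> would
  have the digit \<open>M mod 3 = 2\<close> in the same position.\<close>

lemma both_omit_trivial:
  assumes "M mod 3 = 2" "x \<in> both_omit M"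
  shows "residue x n = 0"
proof (induction n)
  case (Suc n)
  let ?d = "digit x n" and ?r = "digit (x * of_nat M) n"
  have d: "?d \<in> {0, 1}" "?r \<in> {0, 1}"
    using assms(2) unfolding both_omit_def omits_digit_2_def by blast+
  have "residue (x * of_nat M) n = 0" by (simp add: residue_mult_of_nat Suc)
  then have "int ?r * 3 ^ n = int ?d * 3 ^ n * int M mod (3 ^ Suc n)"
    using residue_mult_of_nat[of x M "Suc n"] Suc by (simp add: residue_Suc_digit)
  also have "\<dots> = (int ?d * int M * 3 ^ n) mod (3 * 3 ^ n)" by (simp only: mult_ac power_Suc)
  also have "\<dots> = (int ?d * int M) mod 3 * 3 ^ n" by (rule mod_mult_mult2)
  finally have "int ?r = (int ?d * int M) mod 3" by simp
  moreover have "int M mod 3 = 2" using assms(1) by presburger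
  ultimately have "?d = 0" using d by auto
  with Suc show ?case by (simp add: residue_Suc_digit)
qed simp

section \<open>Upper bounds for the Hausdorff dimension from residue counts\<close>

lemma hausdorff_measure_mono: "A \<subseteq> B \<Longrightarrow> hausdorff_measure s A \<le> hausdorff_measure s B"
  unfolding hausdorff_measure_def hausdorff_premeasure_def
  by (intro SUP_mono' INF_superset_mono) auto

lemma hausdorff_dim_mono:
  assumes "A \<subseteq> B"
  shows "hausdorff_dim A \<le> hausdorff_dim B"
proof -
  have "hausdorff_measure s A = 0" if "hausdorff_measure s B = 0" for s
    using hausdorff_measure_mono[OF assms, of s] that by simp
  then show ?thesis unfolding hausdorff_dim_def by (intro Inf_superset_mono) blast
qed

lemma bounded_diameter_residue_class:
  assumes "\<And>x y. x \<in> U \<Longrightarrow> y \<in> U \<Longrightarrow> residue x n = residue y n"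
  shows "bounded U" "diameter U \<le> 1 / 3 ^ n"
proof -
  have *: "dist x y \<le> 1 / 3 ^ n" if "x \<in> U" "y \<in> U" for x y
    using assms[OF that] by (simp add: dist_padic3_le_iff)
  show "bounded U" unfolding bounded_any_center by (metis * bounded_def)
  show "diameter U \<le> 1 / 3 ^ n"
    unfolding diameter_def using * by (auto intro!: cSUP_least)
qed

text \<open>Each \<open>A i\<close> is covered by its residue classes modulo a power of 3 at cost at
  most \<open>e * (1 / 2) ^ Suc i\<close>. These costs add up to \<open>e\<close>, and large
  exponents keep the diameters below \<open>\<delta>\<close>.\<close>

lemma hausdorff_measure_zero_if_residues:
  fixes A :: "nat \<Rightarrow> padic3 set"
  assumes s: "s > 0" and A: "B \<subseteq> (\<Union>i. A i)"
    and few: "\<And>i L e. e > 0 \<Longrightarrow>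
      \<exists>n\<ge>L. real (card ((\<lambda>x. residue x n) ` A i)) * (1 / 3 ^ n) powr s \<le> e"
  shows "hausdorff_measure s B = 0"
proof -
  have "hausdorff_premeasure s \<delta> B \<le> 0 + ennreal e" if \<delta>: "\<delta> > 0" and e: "e > 0" for \<delta> e :: real
  proof -
    obtain L where L: "(1 / 3) ^ L < \<delta>" using real_arch_pow_inv[OF \<delta>, of "1 / 3"] by auto
    have "\<exists>n\<ge>L. real (card ((\<lambda>x. residue x n) ` A i)) * (1 / 3 ^ n) powr s \<le> e * (1 / 2) ^ Suc i" for i
      using e by (intro few) simp
    then obtain n where n: "\<And>i. n i \<ge> L"
      "\<And>i. real (card ((\<lambda>x. residue x (n i)) ` A i)) * (1 / 3 ^ n i) powr s \<le> e * (1 / 2) ^ Suc i"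
      by metis
    \<comment> \<open>Covers are sequences, so the classes are indexed by pairs through
      \<open>prod_decode\<close>; an index that is no residue gives the empty set, which contributes
      0.\<close>
    define V where "V = (\<lambda>(i, j). {x \<in> A i. residue x (n i) = int j})"
    define U where "U k = V (prod_decode k)" for k
    have V_eq: "residue x (n (fst p)) = residue y (n (fst p))" if "x \<in> V p" "y \<in> V p" for x y p
      using that by (cases p) (simp add: V_def)
    have V: "bounded (V p)" "diameter (V p) \<le> 1 / 3 ^ n (fst p)" for p
      using bounded_diameter_residue_class[OF V_eq] by simp_all
    have V\<delta>: "diameter (V p) \<le> \<delta>" for p
    proof -
      have "(1 / 3) ^ n (fst p) \<le> (1 / 3 :: real) ^ L"
        using n(1)[of "fst p"] by (intro power_decreasing) auto
      with V(2)[of p] L show ?thesis by (simp add: power_one_over)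
    qed
    have "B \<subseteq> (\<Union>k. U k)"
    proof
      fix x assume "x \<in> B"
      then obtain i where "x \<in> A i" using A by blast
      then have "x \<in> V (i, nat (residue x (n i)))" by (simp add: V_def residue_nonneg)
      then have "x \<in> U (prod_encode (i, nat (residue x (n i))))" by (simp add: U_def)
      then show "x \<in> (\<Union>k. U k)" by blast
    qed
    then have "hausdorff_premeasure s \<delta> B \<le> (\<Sum>k. diam_pow s (U k))"
      unfolding hausdorff_premeasure_def using V V\<delta> by (intro INF_lower) (auto simp: U_def)
    also have "\<dots> = (\<Sum>i. \<Sum>j. diam_pow s (V (i, j)))"
      unfolding U_def by (rule suminf_ennreal_2dimen) simp
    also have "\<dots> \<le> (\<Sum>i. ennreal (e * (1 / 2) ^ Suc i))"
    proof (intro suminf_le summableI)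
      fix i
      let ?R = "(\<lambda>x. residue x (n i)) ` A i"
      let ?c = "(1 / 3 ^ n i) powr s"
      define J where "J = nat ` ?R"
      have J: "finite J" "card J \<le> card ?R"
        unfolding J_def using finite_residues card_image_le by blast+
      have "diam_pow s (V (i, j)) = 0" if "j \<notin> J" for j
        using that by (force simp: diam_pow_def V_def J_def)
      then have "(\<Sum>j. diam_pow s (V (i, j))) = (\<Sum>j\<in>J. diam_pow s (V (i, j)))"
        using J(1) by (intro suminf_finite) auto
      also have "\<dots> \<le> (\<Sum>j\<in>J. ennreal ?c)"
      proof (rule sum_mono)
        fix j
        have "0 \<le> diameter (V (i, j))" using V by (intro diameter_ge_0)
        then have "diameter (V (i, j)) powr s \<le> ?c"
          using V(2)[of "(i, j)"] s by (intro powr_mono2) auto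
        then show "diam_pow s (V (i, j)) \<le> ennreal ?c"
          using s by (auto simp: diam_pow_def intro: ennreal_leI)
      qed
      also have "\<dots> = ennreal (real (card J) * ?c)"
        by (simp add: ennreal_mult ennreal_of_nat_eq_real_of_nat)
      also have "\<dots> \<le> ennreal (real (card ?R) * ?c)"
        using J(2) by (intro ennreal_leI mult_right_mono) auto
      also have "\<dots> \<le> ennreal (e * (1 / 2) ^ Suc i)" using n(2) by (rule ennreal_leI)
      finally show "(\<Sum>j. diam_pow s (V (i, j))) \<le> ennreal (e * (1 / 2) ^ Suc i)" .
    qed
    also have "\<dots> = ennreal (\<Sum>i. e * (1 / 2) ^ Suc i)"
      using e power_half_series by (intro suminf_ennreal2 summable_mult) (auto simp: sums_iff)
    also have "(\<Sum>i. e * (1 / 2) ^ Suc i) = e"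
      using sums_mult[OF power_half_series, of e] by (simp only: sums_iff mult_1_right)
    finally show ?thesis by simp
  qed
  then have "hausdorff_premeasure s \<delta> B = 0" if "\<delta> > 0" for \<delta>
    using that by (metis ennreal_le_epsilon le_zero_eq)
  then show ?thesis unfolding hausdorff_measure_def by (intro SUP_eq_const) auto
qed

text \<open>In dimension \<open>a + e\<close>, the classes modulo \<open>3 ^ n\<close> contribute at
  most \<open>3 powr (- e * n)\<close>, which tends to 0. Counts along the multiples of
  \<open>m i\<close> suffice, which admits counting by blocks.\<close>

lemma hausdorff_dim_le_if_residues:
  fixes A :: "nat \<Rightarrow> padic3 set"
  assumes a: "a \<ge> 0" and A: "B \<subseteq> (\<Union>i. A i)" and m: "\<And>i. m i > 0"
    and few: "\<And>i k. real (card ((\<lambda>x. residue x (m i * k)) ` A i)) \<le> 3 powr (a * real (m i * k))"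
  shows "hausdorff_dim B \<le> ereal a"
proof (rule ereal_le_epsilon2)
  fix e :: real assume e: "e > 0"
  have "hausdorff_measure (a + e) B = 0"
  proof (rule hausdorff_measure_zero_if_residues[OF _ A])
    show "a + e > 0" using a e by simp
    fix i L and \<epsilon> :: real assume \<epsilon>: "\<epsilon> > 0"
    have "1 / 3 powr e < (1 :: real)" using e by simp
    then obtain k0 where k0: "(1 / 3 powr e) ^ k0 < \<epsilon>" using real_arch_pow_inv[OF \<epsilon>] by blast
    define k where "k = max k0 L"
    let ?n = "m i * k"
    have "k \<le> ?n" using m[of i] by simp
    then have nk: "?n \<ge> k0" "?n \<ge> L" by (simp_all add: k_def)
    have "real (card ((\<lambda>x. residue x ?n) ` A i)) * (1 / 3 ^ ?n) powr (a + e)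
        \<le> 3 powr (a * real ?n) * (1 / 3 ^ ?n) powr (a + e)"
      by (intro mult_right_mono few) simp
    also have "\<dots> = 3 powr (a * real ?n) * (3 powr (- real ?n)) powr (a + e)"
      by (simp only: powr_minus_divide powr_realpow zero_less_numeral)
    also have "\<dots> = 3 powr (- e * real ?n)"
      by (simp add: algebra_simps powr_powr flip: powr_add)
    also have "\<dots> = (1 / 3 powr e) ^ ?n"
      by (simp add: powr_powr powr_minus_divide power_one_over flip: powr_realpow)
    also have "\<dots> \<le> (1 / 3 powr e) ^ k0" using e nk ge_one_powr_ge_zero[of 3 e]
      by (intro power_decreasing) auto
    finally show "\<exists>n\<ge>L. real (card ((\<lambda>x. residue x n) ` A i)) * (1 / 3 ^ n) powr (a + e) \<le> \<epsilon>"
      using nk k0 by (intro exI[of _ ?n]) linarith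
  qed
  then show "hausdorff_dim B \<le> ereal a + ereal e"
    unfolding hausdorff_dim_def using a e by (intro Inf_lower) auto
qed

section \<open>Lower bounds for the Hausdorff dimension from sparse digits\<close>

text \<open>
  Mass distribution: \<open>g\<close> has a H\<ouml>lder continuous inverse of exponent \<open>a\<close>, so a cover of its
  image pulls back to a cover of the unit interval by sets of length \<open>O(diam\<^sup>a)\<close>.
\<close>

lemma hausdorff_dim_ge_if_inverse_Hoelder:
  fixes g :: "real \<Rightarrow> 'a :: metric_space"
  assumes g: "\<And>y. y \<in> {0..<1} \<Longrightarrow> g y \<in> A" and C: "C \<ge> 1"
    and Hoelder: "\<And>y z. y \<in> {0..<1} \<Longrightarrow> z \<in> {0..<1} \<Longrightarrow> \<bar>y - z\<bar> \<le> C * dist (g y) (g z) powr a"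
  shows "ereal a \<le> hausdorff_dim A"
  unfolding hausdorff_dim_def
proof (rule Inf_greatest)
  fix t assume "t \<in> {ereal s | s. 0 \<le> s \<and> hausdorff_measure s A = 0}"
  then obtain s where s: "t = ereal s" "0 \<le> s" "hausdorff_measure s A = 0" by blast
  show "ereal a \<le> t"
  proof (rule ccontr)
    assume "\<not> ereal a \<le> t"
    then have sa: "s < a" by (simp add: s)
    \<comment> \<open>The measure dominates the premeasure at scale 1. For distances
      \<open>d \<le> 1\<close>, \<open>s < a\<close> gives
      \<open>d powr a \<le> d powr s\<close>.\<close>
    have cover_sum: "1 \<le> ennreal (2 * C) * (\<Sum>i. diam_pow s (U i))"
      if cover: "A \<subseteq> (\<Union>i. U i)" and U: "\<And>i. bounded (U i)" "\<And>i. diameter (U i) \<le> 1"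
      for U :: "nat \<Rightarrow> 'a set"
    proof -
      define V where "V i = g -` U i \<inter> {0..<1}" for i
      \<comment> \<open>\<open>V i\<close> may fail to be measurable, so it is enclosed in an
        interval centred at one of its points; the length of that interval yields the factor
        \<open>2 * C\<close>.\<close>
      have "\<exists>I \<in> sets lborel. V i \<subseteq> I \<and> emeasure lborel I \<le> ennreal (2 * C) * diam_pow s (U i)" for i
      proof (cases "V i = {}")
        case False
        then obtain y where y: "y \<in> V i" by blast
        define D where "D = (if s = 0 then 1 else diameter (U i) powr s)"
        have D: "D \<ge> 0" "diam_pow s (U i) = ennreal D"
          using y by (auto simp: D_def diam_pow_def V_def)
        have "V i \<subseteq> {y - C * D..y + C * D}"
        proof
          fix z assume z: "z \<in> V i"
          let ?d = "dist (g y) (g z)"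
          have d: "0 \<le> ?d" "?d \<le> diameter (U i)"
            using y z diameter_bounded_bound[OF U(1)[of i], of "g y" "g z"]
            unfolding V_def by auto
          have "?d powr a \<le> D"
          proof (cases "s = 0")
            case True
            have "?d powr a \<le> 1 powr a" using d U[of i] sa s by (intro powr_mono2) auto
            with True show ?thesis by (simp add: D_def)
          next
            case False
            have "?d powr a \<le> ?d powr s" using d U[of i] sa by (intro powr_mono') auto
            also have "\<dots> \<le> diameter (U i) powr s" using d s by (intro powr_mono2) auto
            finally show ?thesis using False by (simp add: D_def)
          qed
          then have "C * ?d powr a \<le> C * D" using C by simp
          with Hoelder[of y z] y z have "\<bar>y - z\<bar> \<le> C * D" unfolding V_def by force
          then show "z \<in> {y - C * D..y + C * D}" by auto
        qed
        moreover have "emeasure lborel {y - C * D..y + C * D} = ennreal (2 * C * D)"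
          using D C by simp
        ultimately show ?thesis using C D
          by (intro bexI[of _ "{y - C * D..y + C * D}"]) (auto simp: ennreal_mult)
      next
        case True
        then show ?thesis by (intro bexI[of _ "{}"]) simp_all
      qed
      then obtain I where I: "\<And>i. I i \<in> sets lborel" "\<And>i. V i \<subseteq> I i"
        "\<And>i. emeasure lborel (I i) \<le> ennreal (2 * C) * diam_pow s (U i)"
        by metis
      have "{0..<1} \<subseteq> (\<Union>i. I i)"
      proof
        fix y :: real assume y: "y \<in> {0..<1}"
        from subsetD[OF cover g[OF y]] obtain i where "g y \<in> U i" by blast
        with y have "y \<in> V i" by (simp add: V_def)
        with I(2) show "y \<in> (\<Union>i. I i)" by blast
      qed
      then have "emeasure lborel {0..<1::real} \<le> emeasure lborel (\<Union>i. I i)"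
        using I(1) by (intro emeasure_mono) auto
      also have "\<dots> \<le> (\<Sum>i. emeasure lborel (I i))"
        using I(1) by (intro emeasure_subadditive_countably) auto
      also have "\<dots> \<le> (\<Sum>i. ennreal (2 * C) * diam_pow s (U i))"
        using I(3) by (intro suminf_le) auto
      finally show ?thesis by simp
    qed
    have "ennreal (1 / (2 * C)) * 1 \<le> (\<Sum>i. diam_pow s (U i))"
      if "A \<subseteq> (\<Union>i. U i)" "\<forall>i. bounded (U i) \<and> diameter (U i) \<le> 1" for U :: "nat \<Rightarrow> 'a set"
    proof -
      have "ennreal (1 / (2 * C)) * 1 \<le>
          ennreal (1 / (2 * C)) * (ennreal (2 * C) * (\<Sum>i. diam_pow s (U i)))"
        using that by (intro mult_left_mono cover_sum) simp_all
      also have "\<dots> = (\<Sum>i. diam_pow s (U i))"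
        using C by (simp add: mult.assoc[symmetric] ennreal_mult[symmetric])
      finally show ?thesis .
    qed
    then have "ennreal (1 / (2 * C)) \<le> hausdorff_premeasure s 1 A"
      unfolding hausdorff_premeasure_def by (intro INF_greatest) auto
    also have "\<dots> \<le> hausdorff_measure s A"
      unfolding hausdorff_measure_def by (intro SUP_upper) simp
    finally show False using s C by (simp add: ennreal_eq_0_iff)
  qed
qed

text \<open>This recursion rebuilds the floors from binary digits, so that equal leading digits give
  equal floors on the unit interval.\<close>

lemma floor_power2_Suc:
  "\<lfloor>2 ^ Suc q * y\<rfloor> = 2 * \<lfloor>2 ^ q * y\<rfloor> + \<lfloor>2 ^ Suc q * y\<rfloor> mod 2" for y :: real
proof -
  have "\<lfloor>2 ^ Suc q * y\<rfloor> div 2 = \<lfloor>2 ^ q * y\<rfloor>"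
    using floor_divide_real_eq_div[of 2 "2 ^ Suc q * y"] by simp
  then show ?thesis using mult_div_mod_eq[of 2 "\<lfloor>2 ^ Suc q * y\<rfloor>"] by simp
qed

text \<open>\<open>g\<close> places the binary digits of \<open>y\<close> at the multiples of
  \<open>k\<close>. Agreement modulo \<open>3 ^ (k * q)\<close> puts \<open>y\<close> and
  \<open>z\<close> within \<open>1 / 2 ^ q\<close>, so the inverse is Hoelder continuous with
  exponent \<open>log 3 2 / k\<close>.\<close>

lemma hausdorff_dim_ge_if_sparse_subset:
  assumes k: "k > 0"
    and A: "\<And>x b. (\<And>t. b t \<in> {0, 1}) \<Longrightarrow>
      is_expansion x (\<lambda>j. if j mod k = 0 then b (j div k) else 0) \<Longrightarrow> x \<in> A"
  shows "ereal (1 / real k * log 3 2) \<le> hausdorff_dim A"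
proof -
  define b where "b y t = nat (\<lfloor>2 ^ Suc t * y\<rfloor> mod 2)" for y :: real and t
  have b: "b y t \<in> {0, 1}" for y t unfolding b_def by auto
  define d where "d y j = (if j mod k = 0 then b y (j div k) else 0)" for y j
  have "\<exists>x. is_expansion x (d y)" for y
  proof (rule ex_expansion)
    show "d y j \<in> {0, 1, 2}" for j using b[of y "j div k"] by (auto simp: d_def)
  qed
  then obtain g where g: "\<And>y. is_expansion (g y) (d y)" by metis
  let ?a = "1 / real k * log 3 2"
  have agree: "\<bar>y - z\<bar> \<le> 1 / 2 ^ q"
    if yz: "y \<in> {0..<1}" "z \<in> {0..<1}" and res: "residue (g y) (k * q) = residue (g z) (k * q)"
    for y z :: real and q
  proof -
    have eq: "b y t = b z t" if "t < q" for t
    proof -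
      have "digit (g y) (k * t) = digit (g z) (k * t)"
        using res that k unfolding residue_eq_iff_digit by simp
      then show ?thesis using k by (simp add: digit_eqI[OF g] d_def)
    qed
    have "\<lfloor>2 ^ p * y\<rfloor> = \<lfloor>2 ^ p * z\<rfloor>" if "p \<le> q" for p
      using that
    proof (induction p)
      case 0
      have "\<lfloor>y\<rfloor> = 0" "\<lfloor>z\<rfloor> = 0" using yz by (simp_all add: floor_eq_iff)
      then show ?case by simp
    next
      case (Suc p)
      have "\<lfloor>2 ^ Suc p * y\<rfloor> mod 2 = \<lfloor>2 ^ Suc p * z\<rfloor> mod 2"
        using eq[of p] Suc.prems by (simp add: b_def eq_nat_nat_iff)
      then show ?case using Suc floor_power2_Suc[of p y] floor_power2_Suc[of p z] by simp
    qed
    from this[of q] have "\<bar>2 ^ q * y - 2 ^ q * z\<bar> \<le> 1" by linarith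
    also have "\<bar>2 ^ q * y - 2 ^ q * z\<bar> = 2 ^ q * \<bar>y - z\<bar>"
      by (simp add: abs_mult flip: right_diff_distrib)
    finally show ?thesis by (simp add: field_simps)
  qed
  show ?thesis
  proof (rule hausdorff_dim_ge_if_inverse_Hoelder[where g = g and C = 2])
    show "g y \<in> A" for y using A b g unfolding d_def by blast
    fix y z :: real assume yz: "y \<in> {0..<1}" "z \<in> {0..<1}"
    show "\<bar>y - z\<bar> \<le> 2 * dist (g y) (g z) powr ?a"
    proof (cases "g y = g z")
      case True
      have "y = z"
      proof (rule ccontr)
        assume "y \<noteq> z"
        then obtain q where "(1 / 2) ^ q < \<bar>y - z\<bar>"
          using real_arch_pow_inv[of "\<bar>y - z\<bar>" "1 / 2"] by auto
        with agree[OF yz, of q] True show False by (simp add: power_one_over)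
      qed
      then show ?thesis by simp
    next
      case False
      then obtain v where v: "dist (g y) (g z) = 1 / 3 ^ v" by (auto simp: dist_padic3_def)
      let ?q = "v div k"
      have "residue (g y) v = residue (g z) v"
        by (rule dist_padic3_le_iff[THEN iffD1]) (simp add: v)
      then have "residue (g y) (k * ?q) = residue (g z) (k * ?q)"
        by (rule residue_eq_mono) simp
      from agree[OF yz this] have "\<bar>y - z\<bar> \<le> 2 powr (- real ?q)"
        by (simp add: powr_minus_divide powr_realpow)
      \<comment> \<open>Rounding \<open>v / k\<close> down to \<open>?q\<close> loses less than 1 in
        the exponent, whence the constant 2.\<close>
      also have "\<dots> \<le> 2 powr (1 - real v / real k)"
      proof -
        have "v < k * Suc ?q" using k dividend_less_times_div by (simp add: algebra_simps)
        then have "real v < real k * (real ?q + 1)" by (metis of_nat_Suc of_nat_less_iff of_nat_mult add.commute)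
        then have "real v / real k \<le> real ?q + 1" using k by (simp add: divide_le_eq mult.commute)
        then show ?thesis by simp
      qed
      also have "\<dots> = 2 * 2 powr (- real v / real k)" by (simp add: powr_diff powr_minus_divide)
      also have "2 powr (- real v / real k) = (3 powr log 3 2) powr (- real v / real k)" by simp
      also have "\<dots> = (3 powr (- real v)) powr ?a" by (simp only: powr_powr) (simp add: mult.commute)
      also have "3 powr (- real v) = dist (g y) (g z)"
        by (simp add: v powr_minus_divide powr_realpow)
      finally show ?thesis .
    qed
  qed simp
qed

text \<open>Positions are grouped into blocks of length \<open>k\<close>; within block
  \<open>t\<close> the factor \<open>b t * 3 ^ (k * t)\<close> is constant.\<close>

lemma sum_digit_blocks:
  fixes b c :: "nat \<Rightarrow> nat"
  assumes "k > 0"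
  shows "(\<Sum>j<k * q. b (j div k) * c (j mod k) * 3 ^ j) =
    (\<Sum>t<q. b t * 3 ^ (k * t)) * (\<Sum>i<k. c i * 3 ^ i)"
proof -
  have block: "(\<Sum>j = t * k..<t * k + k. b (j div k) * c (j mod k) * 3 ^ j) =
      b t * 3 ^ (k * t) * (\<Sum>i<k. c i * 3 ^ i)" for t
  proof -
    have "(\<Sum>j = t * k..<t * k + k. b (j div k) * c (j mod k) * 3 ^ j) =
        (\<Sum>i<k. b ((t * k + i) div k) * c ((t * k + i) mod k) * 3 ^ (t * k + i))"
      by (subst sum.atLeastLessThan_shift_0) (simp only: add_diff_cancel_left' atLeast0LessThan o_def)
    also have "\<dots> = (\<Sum>i<k. b t * 3 ^ (k * t) * (c i * 3 ^ i))"
      by (intro sum.cong) (simp_all add: power_add mult_ac)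
    finally show ?thesis by (simp add: sum_distrib_left)
  qed
  have "(\<Sum>j<k * q. b (j div k) * c (j mod k) * 3 ^ j) =
      (\<Sum>t<q. \<Sum>j = t * k..<t * k + k. b (j div k) * c (j mod k) * 3 ^ j)"
    by (simp only: sum.nat_group mult.commute[of k q])
  also have "\<dots> = (\<Sum>t<q. b t * 3 ^ (k * t)) * (\<Sum>i<k. c i * 3 ^ i)"
    by (simp only: block sum_distrib_right)
  finally show ?thesis .
qed

text \<open>
  Multiplying by \<open>M < 3\<^sup>k\<close> a number whose nonzero digits sit at multiples of \<open>k\<close> produces no
  carries: each digit 1 is replaced by the block of ternary digits of \<open>M\<close>.
\<close>

lemma omits_digit_2_sparse_mult:
  assumes k: "k > 0" and b: "\<And>t. b t \<in> {0, 1}" and c: "\<And>i. c i \<in> {0, 1}"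
    and M: "M = (\<Sum>i<k. c i * 3 ^ i)"
    and x: "is_expansion x (\<lambda>j. if j mod k = 0 then b (j div k) else 0)"
  shows "omits_digit_2 (x * of_nat M)"
proof -
  define e where "e j = b (j div k) * c (j mod k)" for j
  have e: "e j \<in> {0, 1}" for j using b[of "j div k"] c[of "j mod k"] by (auto simp: e_def)
  have "\<exists>z. is_expansion z e"
  proof (rule ex_expansion)
    show "e j \<in> {0, 1, 2}" for j using e[of j] by auto
  qed
  then obtain z where z: "is_expansion z e" by blast
  have "z = x * of_nat M"
  proof (rule padic3_eqI)
    fix n
    let ?B = "\<Sum>t<n. b t * 3 ^ (k * t)"
    have "residue x (k * n) = int (\<Sum>j<k * n. (if j mod k = 0 then b (j div k) else 0) * 3 ^ j)"
      using x unfolding is_expansion_iff by blast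
    \<comment> \<open>The expansion of \<open>x\<close> is itself of block form, with the digits of
      the number 1 as block.\<close>
    also have "(\<Sum>j<k * n. (if j mod k = 0 then b (j div k) else 0) * 3 ^ j) =
        (\<Sum>j<k * n. b (j div k) * (if j mod k = 0 then 1 else 0) * 3 ^ j)"
      by (intro sum.cong) auto
    also have "\<dots> = ?B * (\<Sum>i<k. (if i = 0 then 1 else 0) * 3 ^ i)"
      by (rule sum_digit_blocks[OF k, where c = "\<lambda>i. if i = 0 then 1 else 0"])
    also have "(\<Sum>i<k. (if i = 0 then 1 else 0) * 3 ^ i) = (\<Sum>i<k. if i = 0 then 1 else 0 :: nat)"
      by (intro sum.cong) auto
    also have "\<dots> = 1" using k by simp
    finally have x_res: "residue x (k * n) = int ?B" by simp
    have "residue z (k * n) = int (\<Sum>j<k * n. e j * 3 ^ j)"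
      using z unfolding is_expansion_iff by blast
    then have z_res: "residue z (k * n) = int ?B * int M"
      using sum_digit_blocks[OF k, of b c n] by (simp add: e_def M)
    have "residue (x * of_nat M) (k * n) = residue z (k * n)"
      using residue_mod_self[of z "k * n"] unfolding residue_mult_of_nat x_res z_res .
    then have "residue z (k * n) = residue (x * of_nat M) (k * n)" by (rule sym)
    then show "residue z n = residue (x * of_nat M) n" by (rule residue_eq_mono) (use k in simp)
  qed
  with digit_eqI[OF z] e show ?thesis unfolding omits_digit_2_def by simp
qed

section \<open>Dimension bounds for the exceptional sets\<close>

text \<open>Every sparse number has all of \<open>N\<close> as admissible exponents, because each
  \<open>2 ^ n\<close> fits into one block of \<open>k\<close> digits 0 and 1.\<close>

lemma hausdorff_dim_exceptional_set_ge:
  assumes k: "k > 0" and N: "finite N"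
    and digits: "\<And>n. n \<in> N \<Longrightarrow> \<exists>c. (\<forall>i. c i \<in> {0, 1}) \<and> 2 ^ n = (\<Sum>i<k. c i * 3 ^ i :: nat)"
  shows "ereal (1 / real k * log 3 2) \<le> hausdorff_dim (exceptional_set (card N))"
proof (rule hausdorff_dim_ge_if_sparse_subset[OF k])
  fix x :: padic3 and b :: "nat \<Rightarrow> nat"
  assume b: "\<And>t. b t \<in> {0, 1}"
    and x: "is_expansion x (\<lambda>j. if j mod k = 0 then b (j div k) else 0)"
  have "omits_digit_2 (x * 2 ^ n)" if n: "n \<in> N" for n
  proof -
    from digits[OF n] obtain c where c: "\<And>i. c i \<in> {0, 1}" "2 ^ n = (\<Sum>i<k. c i * 3 ^ i :: nat)"
      by blast
    from omits_digit_2_sparse_mult[OF k b c x] show ?thesis by simp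
  qed
  with N show "x \<in> exceptional_set (card N)" unfolding exceptional_set_def by blast
qed

text \<open>\<open>M\<close> is a unit modulo \<open>3 ^ n\<close>, so residues may be counted after
  multiplication by \<open>M\<close>.\<close>

lemma card_residues_mult:
  assumes "coprime M 3"
  shows "card ((\<lambda>x. residue x n) ` A) \<le> card ((\<lambda>x. residue x n) ` (\<lambda>x. x * of_nat M) ` A)"
proof -
  have "finite ((\<lambda>x. residue (x * of_nat M) n) ` A)"
    using finite_residues[of n "(\<lambda>x. x * of_nat M) ` A"] by (simp only: image_image)
  then have "card ((\<lambda>x. residue x n) ` A) \<le> card ((\<lambda>x. residue (x * of_nat M) n) ` A)"
    by (rule card_image_le_of_factor[THEN conjunct2]) (rule residue_mult_cancel[OF assms])
  then show ?thesis by (simp only: image_image)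
qed

lemma coprime_2_power_3: "coprime (2 ^ n) (3 :: nat)"
  by (simp add: coprime_power_left_iff primes_coprime)

lemma hausdorff_dim_exceptional_set_1_le: "hausdorff_dim (exceptional_set 1) \<le> ereal (log 3 2)"
proof (rule hausdorff_dim_le_if_residues)
  let ?A = "\<lambda>n. {x. omits_digit_2 (x * of_nat (2 ^ n))}"
  show "exceptional_set 1 \<subseteq> (\<Union>n. ?A n)"
    unfolding exceptional_set_def by (auto simp: card_1_singleton_iff)
  fix n k :: nat
  have "card ((\<lambda>x. residue x k) ` ?A n) \<le> card ((\<lambda>x. residue x k) ` (\<lambda>x. x * of_nat (2 ^ n)) ` ?A n)"
    by (intro card_residues_mult coprime_2_power_3)
  also have "\<dots> \<le> 2 ^ k" by (rule card_residues_omits) blast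
  finally have "real (card ((\<lambda>x. residue x k) ` ?A n)) \<le> 2 ^ k" by (metis of_nat_le_iff of_nat_numeral of_nat_power)
  also have "(2 :: real) ^ k = (3 powr log 3 2) powr real k" by (simp add: powr_realpow)
  also have "\<dots> = 3 powr (log 3 2 * real (1 * k))" unfolding powr_powr by simp
  finally show "real (card ((\<lambda>x. residue x (1 * k)) ` ?A n)) \<le> 3 powr (log 3 2 * real (1 * k))"
    by simp
qed simp_all

text \<open>For even \<open>n\<close>, \<open>2 ^ n\<close> is 1 modulo 3 and the pair count applies
  with \<open>l = 2 * m\<close>, \<open>m\<close> being the multiplicity of 3 in
  \<open>2 ^ n - 1\<close>. For odd \<open>n\<close> it is 2 modulo 3, and only 0 can
  survive.\<close>

lemma card_residues_both_omit_2_power: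
  assumes "n > 0"
  shows "\<exists>l>0. \<forall>k. real (card ((\<lambda>x. residue x (l * k)) ` both_omit (2 ^ n)))
    \<le> 3 powr (1 / 2 * real (l * k))"
proof (cases "even n")
  case True
  have "int (2 ^ n) - 1 \<noteq> 0" using assms by simp
  moreover have "\<not> is_unit (3 :: int)" by simp
  ultimately obtain u where
    u: "int (2 ^ n) - 1 = 3 ^ multiplicity 3 (int (2 ^ n) - 1) * u" "\<not> 3 dvd u"
    by (rule multiplicity_decompose')
  define m where "m = multiplicity 3 (int (2 ^ n) - 1)"
  have M: "int (2 ^ n) - 1 = 3 ^ m * u" using u(1) by (simp only: m_def)
  from True obtain c where c: "n = 2 * c" by blast
  have "(4 :: int) ^ c mod 3 = 1" by (simp flip: power_mod[of 4 3 c])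
  then have "3 dvd int (2 ^ n) - 1" by (simp add: c power_mult mod_eq_dvd_iff[symmetric])
  with u(2) M have m: "m > 0" by (cases m) simp_all
  show ?thesis
  proof (intro exI[of _ "2 * m"] conjI allI)
    fix k
    have "real (card ((\<lambda>x. residue x (2 * m * k)) ` both_omit (2 ^ n))) \<le> real (3 ^ (m * k))"
      using card_residues_both_omit[OF M u(2) m] by (simp only: of_nat_le_iff)
    also have "\<dots> = 3 powr (1 / 2 * real (2 * m * k))" by (simp flip: powr_realpow)
    finally show "real (card ((\<lambda>x. residue x (2 * m * k)) ` both_omit (2 ^ n)))
      \<le> 3 powr (1 / 2 * real (2 * m * k))" .
  qed (use m in simp)
next
  case False
  then obtain c where c: "n = 2 * c + 1" by (rule oddE)
  have "(4 :: nat) ^ c mod 3 = 1" by (simp flip: power_mod[of 4 3 c])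
  then have "(2 * 4 ^ c) mod 3 = (2 :: nat)" by presburger
  then have "2 ^ n mod 3 = (2 :: nat)" by (simp add: c power_mult)
  then have "(\<lambda>x. residue x k) ` both_omit (2 ^ n) \<subseteq> {0}" for k
    using both_omit_trivial by blast
  then have "card ((\<lambda>x. residue x k) ` both_omit (2 ^ n)) \<le> card {0 :: int}" for k
    by (rule card_mono[rotated]) simp
  then have *: "real (card ((\<lambda>x. residue x k) ` both_omit (2 ^ n))) \<le> 1" for k by simp
  show ?thesis
  proof (intro exI[of _ 1] conjI allI)
    fix k
    have "1 \<le> (3 :: real) powr (1 / 2 * real (1 * k))" by (intro ge_one_powr_ge_zero) simp_all
    with * show "real (card ((\<lambda>x. residue x (1 * k)) ` both_omit (2 ^ n)))
      \<le> 3 powr (1 / 2 * real (1 * k))" by (rule order_trans)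
  qed simp
qed

lemma hausdorff_dim_exceptional_set_2_le: "hausdorff_dim (exceptional_set 2) \<le> ereal (1 / 2)"
proof -
  \<comment> \<open>The index \<open>(a, b)\<close> stands for the exponents
    \<open>a < a + Suc b\<close>; multiplication by \<open>2 ^ a\<close> maps its set into
    \<open>both_omit (2 ^ Suc b)\<close>.\<close>
  define A where "A = (\<lambda>(a, b). {x. omits_digit_2 (x * 2 ^ a) \<and> omits_digit_2 (x * 2 ^ (a + Suc b))})"
  have "\<exists>l>0. \<forall>k. real (card ((\<lambda>x. residue x (l * k)) ` A p)) \<le> 3 powr (1 / 2 * real (l * k))" for p
  proof -
    obtain a b where p: "p = (a, b)" by fastforce
    have "(\<lambda>x. x * of_nat (2 ^ a)) ` A p \<subseteq> both_omit (2 ^ Suc b)"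
      unfolding A_def p both_omit_def by (auto simp: power_add mult_ac)
    then have "card ((\<lambda>x. residue x n) ` (\<lambda>x. x * of_nat (2 ^ a)) ` A p)
        \<le> card ((\<lambda>x. residue x n) ` both_omit (2 ^ Suc b))" for n
      by (intro card_mono finite_residues image_mono)
    then have *: "card ((\<lambda>x. residue x n) ` A p) \<le> card ((\<lambda>x. residue x n) ` both_omit (2 ^ Suc b))" for n
      using card_residues_mult[OF coprime_2_power_3] order_trans by blast
    from card_residues_both_omit_2_power[of "Suc b"] obtain l where l: "l > 0"
      "\<And>k. real (card ((\<lambda>x. residue x (l * k)) ` both_omit (2 ^ Suc b))) \<le> 3 powr (1 / 2 * real (l * k))"
      by blast
    have "real (card ((\<lambda>x. residue x (l * k)) ` A p)) \<le> 3 powr (1 / 2 * real (l * k))" for k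
      by (rule order_trans[OF _ l(2)]) (simp only: of_nat_le_iff *)
    with l(1) show ?thesis by blast
  qed
  then obtain l where l: "\<And>p. l p > 0"
    "\<And>p k. real (card ((\<lambda>x. residue x (l p * k)) ` A p)) \<le> 3 powr (1 / 2 * real (l p * k))"
    by metis
  have "exceptional_set 2 \<subseteq> (\<Union>i. A (prod_decode i))"
  proof
    fix x assume "x \<in> exceptional_set 2"
    then obtain N where "card N = 2" and N: "\<And>n. n \<in> N \<Longrightarrow> omits_digit_2 (x * 2 ^ n)"
      unfolding exceptional_set_def by blast
    then obtain m n where "N = {m, n}" "m \<noteq> n" by (auto simp: card_2_iff)
    then obtain a b where ab: "a \<in> N" "b \<in> N" "a < b" by (metis insertCI linorder_neqE_nat)
    define c where "c = b - Suc a"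
    have b: "b = a + Suc c" using ab(3) by (simp add: c_def)
    have "x \<in> A (a, c)"
      unfolding A_def using N[OF ab(1)] N[OF ab(2)[unfolded b]] by (simp only: prod.case mem_Collect_eq simp_thms)
    then have "x \<in> A (prod_decode (prod_encode (a, c)))" by simp
    then show "x \<in> (\<Union>i. A (prod_decode i))" by blast
  qed
  then show ?thesis
    by (rule hausdorff_dim_le_if_residues[where m = "\<lambda>i. l (prod_decode i)" and
          A = "\<lambda>i. A (prod_decode i)", rotated, OF _ l]) simp
qed

section \<open>Nesting, the value of \<open>log 3 2\<close>, and the three claims\<close>

lemma exceptional_set_antimono:
  assumes "j \<le> k"
  shows "exceptional_set k \<subseteq> exceptional_set j"
proof
  fix x assume "x \<in> exceptional_set k"
  then obtain N where N: "card N = k" "\<forall>n\<in>N. omits_digit_2 (x * 2 ^ n)"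
    unfolding exceptional_set_def by blast
  from assms obtain N' where "N' \<subseteq> N" "card N' = j" "finite N'"
    unfolding N(1)[symmetric] by (rule obtain_subset_with_card_n)
  with N(2) show "x \<in> exceptional_set j" unfolding exceptional_set_def by blast
qed

text \<open>
  306/485 and 665/1054 are consecutive convergents of the continued fraction of \<open>log\<^sub>3 2\<close>.
\<close>

lemma log_3_2_bounds: "0.63092 \<le> log 3 (2 :: real)" "log 3 (2 :: real) < 0.63093"
proof -
  have "306 = log 3 (3 ^ 306 :: real)" by (subst log_nat_power) simp_all
  also have "\<dots> \<le> log 3 (2 ^ 485)" by (subst log_le_cancel_iff) simp_all
  also have "\<dots> = 485 * log 3 2" by (subst log_nat_power) simp_all
  finally show "0.63092 \<le> log 3 (2 :: real)" by simp
  have "1054 * log 3 2 = log 3 (2 ^ 1054 :: real)" by (subst log_nat_power) simp_all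
  also have "\<dots> < log 3 (3 ^ 665)" by (subst log_less_cancel_iff) simp_all
  also have "\<dots> = 665" by (subst log_nat_power) simp_all
  finally show "log 3 (2 :: real) < 0.63093" by simp
qed

theorem theorem1p5:
  shows "(hausdorff_dim (exceptional_set 1) = ereal (log 3 2)
        \<and> 0.63092 \<le> log 3 (2 :: real) \<and> log 3 (2 :: real) < 0.63093)
    \<and> (ereal (1 / 2 * log 3 2) \<le> hausdorff_dim (exceptional_set 2)
        \<and> hausdorff_dim (exceptional_set 2) \<le> ereal (1 / 2))
    \<and> (0 < hausdorff_dim (exceptional_set 3)
        \<and> ereal (1 / 6 * log 3 2) \<le> hausdorff_dim (exceptional_set 3)
        \<and> hausdorff_dim (exceptional_set 3) \<le> hausdorff_dim (exceptional_set 2))"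
proof -
  have digits: "\<exists>c. (\<forall>i. c i \<in> {0, 1}) \<and> M = (\<Sum>i<k. c i * 3 ^ i)"
    if "M = (\<Sum>i<k. of_bool (i \<in> I) * 3 ^ i)" for M k :: nat and I
    using that by (intro exI[of _ "\<lambda>i. of_bool (i \<in> I)"]) simp
  \<comment> \<open>With \<open>k = 1\<close> every position may carry a 1, and the exponent 0 is
    the witness.\<close>
  have 1: "ereal (log 3 2) \<le> hausdorff_dim (exceptional_set 1)"
    using hausdorff_dim_exceptional_set_ge[of 1 "{0}"] digits[of 1 "{0}" 1] by simp
  have "\<exists>c. (\<forall>i. c i \<in> {0, 1}) \<and> 2 ^ n = (\<Sum>i<2. c i * 3 ^ i :: nat)" if "n \<in> {0, 2}" for n :: nat
  proof -
    from that consider "n = 0" | "n = 2" by blast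
    then show ?thesis
    proof cases
      case 1
      show ?thesis by (rule digits[where I = "{0}"]) (simp add: 1 lessThan_nat_numeral)
    next
      case 2
      show ?thesis by (rule digits[where I = "{0, 1}"]) (simp add: 2 lessThan_nat_numeral)
    qed
  qed
  from hausdorff_dim_exceptional_set_ge[of 2 "{0, 2}", OF _ _ this]
  have 2: "ereal (1 / 2 * log 3 2) \<le> hausdorff_dim (exceptional_set 2)"
    by (simp flip: numeral_2_eq_2)
  \<comment> \<open>The largest power, \<open>2 ^ 8 = 1 + 3 + 9 + 3 ^ 5\<close>, has six ternary
    digits, whence \<open>k = 6\<close>.\<close>
  have "\<exists>c. (\<forall>i. c i \<in> {0, 1}) \<and> 2 ^ n = (\<Sum>i<6. c i * 3 ^ i :: nat)" if "n \<in> {0, 2, 8}" for n :: nat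
  proof -
    from that consider "n = 0" | "n = 2" | "n = 8" by blast
    then show ?thesis
    proof cases
      case 1
      show ?thesis by (rule digits[where I = "{0}"]) (simp add: 1 lessThan_nat_numeral)
    next
      case 2
      show ?thesis by (rule digits[where I = "{0, 1}"]) (simp add: 2 lessThan_nat_numeral)
    next
      case 3
      show ?thesis by (rule digits[where I = "{0, 1, 2, 5}"]) (simp add: 3 lessThan_nat_numeral)
    qed
  qed
  from hausdorff_dim_exceptional_set_ge[of 6 "{0, 2, 8}", OF _ _ this]
  have 3: "ereal (1 / 6 * log 3 2) \<le> hausdorff_dim (exceptional_set 3)"
    by (simp flip: numeral_3_eq_3)
  have "0 < ereal (1 / 6 * log 3 2)" by simp
  also note 3
  finally have "0 < hausdorff_dim (exceptional_set 3)" .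
  moreover have "hausdorff_dim (exceptional_set 1) = ereal (log 3 2)"
    using hausdorff_dim_exceptional_set_1_le 1 by (rule antisym)
  moreover have "hausdorff_dim (exceptional_set 3) \<le> hausdorff_dim (exceptional_set 2)"
    by (intro hausdorff_dim_mono exceptional_set_antimono) simp
  ultimately show ?thesis
    using 2 3 log_3_2_bounds hausdorff_dim_exceptional_set_2_le by blast
qed

end
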